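(* Let $\tau$ be a locally convex-solid Hausdorff complete topology on the Dedekind $\sigma$-complete Riesz space $E$. (a) If $E$ has the $(w_\tau,\tau)$-PSP, then for every $\tau$-closed ideal $I$ of $E$ the quotient space $E/I$ has the $(w_{\dot\tau},\dot\tau)$-PSP. (b) If $E$ has the $(w_\tau,\tau)$-SP, then for every $\tau$-closed ideal $I$ of $E$ the quotient space $E/I$ has the $(w_{\dot\tau},\dot\tau)$-SP.
   Context: A locally convex topology on a Riesz space is locally convex-solid if it is generated by a family of Riesz seminorms (equivalently, if the origin has a basis of neighborhoods formed by convex and solid sets). Given linear topologies $\tau_1,\tau_2$ on a Riesz space $E$: $E$ has the $(\tau_1,\tau_2)$-Schur property, $(\tau_1,\tau_2)$-SP, if $\tau_1$-null sequences in $E$ are $\tau_2$-null; $E$ has the $(\tau_1,\tau_2)$-positive Schur property, $(\tau_1,\tau_2)$-PSP, if $\tau_1$-null sequences in $E$ formed by positive elements (i.e. $x_n\ge 0$) are $\tau_2$-null. For a linear topology $\tau$, $w_\tau$ denotes the weak topology with respect to $\tau$, i.e. the weak topology induced by the $\tau$-continuous linear functionals. For an ideal $I$ of $E$, $E/I$ is the quotient Riesz space, ordered by $\dot x\le\dot y$ if there are $x_1\in\dot x$, $y_1\in\dot y$ with $x_1\le y_1$; $\dot\tau$ denotes the quotient topology on $E/I$ (the finest topology making the quotient map $(E,\tau)\to E/I$ continuous), and $w_{\dot\tau}$ is the weak topology of $(E/I,\dot\tau)$. *)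

theory Defs
  imports "HOL-Analysis.Analysis" "HOL-Library.Lattice_Algebras" "HOL-Library.Set_Algebras"
begin

text \<open>Real Riesz spaces (vector lattices); the modulus is the one of
  \<^class>\<open>lattice_ab_group_add_abs\<close>, so that \<open>\<bar>x\<bar> = sup x (- x)\<close>.\<close>

class riesz_space = ordered_real_vector + lattice_ab_group_add_abs

definition dedekind_sigma_complete :: "'a::riesz_space itself \<Rightarrow> bool" where
  "dedekind_sigma_complete _ \<longleftrightarrow>
     (\<forall>x::nat \<Rightarrow> 'a. (\<exists>b. \<forall>n. x n \<le> b) \<longrightarrow>
        (\<exists>s. (\<forall>n. x n \<le> s) \<and> (\<forall>b. (\<forall>n. x n \<le> b) \<longrightarrow> s \<le> b)))"

definition riesz_seminorm :: "('a::riesz_space \<Rightarrow> real) \<Rightarrow> bool" where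
  "riesz_seminorm p \<longleftrightarrow>
     (\<forall>x y. p (x + y) \<le> p x + p y) \<and>
     (\<forall>c x. p (c *\<^sub>R x) = \<bar>c\<bar> * p x) \<and>
     (\<forall>x y. \<bar>x\<bar> \<le> \<bar>y\<bar> \<longrightarrow> p x \<le> p y)"

text \<open>The set \<^term>\<open>UNIV\<close> is added to the subbase only to make the whole space the
  carrier of the topology in the degenerate case of an empty family of seminorms.\<close>

definition seminorm_topology :: "('a::real_vector \<Rightarrow> real) set \<Rightarrow> 'a topology" where
  "seminorm_topology P =
     topology_generated_by (insert UNIV {{y. p (y - x) < e} | p x e. p \<in> P \<and> 0 < e})"

definition locally_convex_solid :: "'a::riesz_space topology \<Rightarrow> bool" where
  "locally_convex_solid T \<longleftrightarrow>
     (\<exists>P. (\<forall>p\<in>P. riesz_seminorm p) \<and> T = seminorm_topology P)"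

text \<open>Completeness with respect to the translation-invariant uniformity of a linear
  topology, stated for filters.\<close>

definition cauchy_filter_on :: "'a::ab_group_add topology \<Rightarrow> 'a filter \<Rightarrow> bool" where
  "cauchy_filter_on T F \<longleftrightarrow>
     (\<forall>U. openin T U \<and> 0 \<in> U \<longrightarrow> eventually (\<lambda>(x, y). x - y \<in> U) (F \<times>\<^sub>F F))"

definition complete_topology :: "'a::ab_group_add topology \<Rightarrow> bool" where
  "complete_topology T \<longleftrightarrow>
     (\<forall>F. F \<noteq> bot \<and> cauchy_filter_on T F \<longrightarrow> (\<exists>l. limitin T (\<lambda>x. x) l F))"

definition riesz_ideal :: "'a::riesz_space set \<Rightarrow> bool" where
  "riesz_ideal I \<longleftrightarrow> subspace I \<and> (\<forall>x y. y \<in> I \<and> \<bar>x\<bar> \<le> \<bar>y\<bar> \<longrightarrow> x \<in> I)"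

text \<open>The quotient by an ideal is not a type, so ordered vector spaces with an explicit
  carrier are used to speak uniformly about a Riesz space and about its quotients.\<close>

record 'a ovs =
  carr :: "'a set"
  add :: "'a \<Rightarrow> 'a \<Rightarrow> 'a"
  zer :: 'a
  scale :: "real \<Rightarrow> 'a \<Rightarrow> 'a"
  leq :: "'a \<Rightarrow> 'a \<Rightarrow> bool"

definition whole_space :: "'a::riesz_space ovs" where
  "whole_space =
     \<lparr>carr = UNIV, add = (+), zer = 0, scale = (*\<^sub>R), leq = (\<le>)\<rparr>"

text \<open>Cosets are the sets \<^term>\<open>x +o I\<close>. Since \<open>0 *\<^sub>R A\<close> would be just \<open>{0}\<close>,
  scalar multiplication adds \<^term>\<open>I\<close> again.\<close>

definition quotient_space :: "'a::riesz_space set \<Rightarrow> 'a set ovs" where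
  "quotient_space I =
     \<lparr>carr = range (\<lambda>x. x +o I),
      add = (\<lambda>A B. A + B),
      zer = 0 +o I,
      scale = (\<lambda>c A. (\<lambda>x. c *\<^sub>R x) ` A + I),
      leq = (\<lambda>A B. \<exists>x\<in>A. \<exists>y\<in>B. x \<le> y)\<rparr>"

lemma quotient_space_coset_ops:
  assumes "riesz_ideal I"
  shows "add (quotient_space I) (x +o I) (y +o I) = (x + y) +o I"
    and "scale (quotient_space I) c (x +o I) = (c *\<^sub>R x) +o I"
proof -
  have sub: "subspace I" using assms by (simp add: riesz_ideal_def)
  have II: "I + I = I"
  proof
    show "I + I \<subseteq> I" using sub by (auto elim!: set_plus_elim intro: subspace_add)
    show "I \<subseteq> I + I"
      using set_zero_plus2[OF subspace_0[OF sub]] by blast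
  qed
  show "add (quotient_space I) (x +o I) (y +o I) = (x + y) +o I"
    by (simp add: quotient_space_def set_plus_rearrange II)
  have im: "(\<lambda>z. c *\<^sub>R z) ` (x +o I) = (c *\<^sub>R x) +o ((\<lambda>z. c *\<^sub>R z) ` I)"
    by (auto simp: elt_set_plus_def image_iff) (metis scaleR_add_right)+
  have "(\<lambda>z. c *\<^sub>R z) ` I + I = I"
  proof
    show "(\<lambda>z. c *\<^sub>R z) ` I + I \<subseteq> I"
      using sub by (auto elim!: set_plus_elim intro: subspace_add subspace_scale)
    have "0 \<in> (\<lambda>z. c *\<^sub>R z) ` I"
      using subspace_0[OF sub] by (auto simp: image_iff intro: bexI[of _ 0])
    then show "I \<subseteq> (\<lambda>z. c *\<^sub>R z) ` I + I"
      by (rule set_zero_plus2)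
  qed
  then show "scale (quotient_space I) c (x +o I) = (c *\<^sub>R x) +o I"
    by (simp add: quotient_space_def im set_plus_rearrange3)
qed

definition quotient_top :: "'a::riesz_space topology \<Rightarrow> 'a set \<Rightarrow> 'a set topology" where
  "quotient_top T I =
     topology (\<lambda>U. U \<subseteq> range (\<lambda>x. x +o I) \<and> openin T {x \<in> topspace T. x +o I \<in> U})"

lemma openin_quotient_top:
  "openin (quotient_top T I) U \<longleftrightarrow>
     U \<subseteq> range (\<lambda>x. x +o I) \<and> openin T {x \<in> topspace T. x +o I \<in> U}"
proof -
  have "istopology
     (\<lambda>U. U \<subseteq> range (\<lambda>x. x +o I) \<and> openin T {x \<in> topspace T. x +o I \<in> U})"
    unfolding istopology_def
  proof (intro conjI allI impI; (elim conjE)?)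
    fix S R
    assume "openin T {x \<in> topspace T. x +o I \<in> S}" "openin T {x \<in> topspace T. x +o I \<in> R}"
    then have "openin T ({x \<in> topspace T. x +o I \<in> S} \<inter> {x \<in> topspace T. x +o I \<in> R})"
      by (rule openin_Int)
    then show "openin T {x \<in> topspace T. x +o I \<in> S \<inter> R}"
      by (rule back_subst[of "openin T"]) auto
  next
    fix K
    assume K: "\<forall>k\<in>K. k \<subseteq> range (\<lambda>x. x +o I) \<and> openin T {x \<in> topspace T. x +o I \<in> k}"
    then have "openin T (\<Union>k\<in>K. {x \<in> topspace T. x +o I \<in> k})"
      by blast
    then show "openin T {x \<in> topspace T. x +o I \<in> \<Union>K}"
      by (rule back_subst[of "openin T"]) auto
    show "\<Union>K \<subseteq> range (\<lambda>x. x +o I)" using K by blast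
  qed auto
  then show ?thesis by (simp add: quotient_top_def topology_inverse')
qed

definition linear_functional :: "('a, 'b) ovs_scheme \<Rightarrow> ('a \<Rightarrow> real) \<Rightarrow> bool" where
  "linear_functional V f \<longleftrightarrow>
     (\<forall>x\<in>carr V. \<forall>y\<in>carr V. f (add V x y) = f x + f y) \<and>
     (\<forall>c. \<forall>x\<in>carr V. f (scale V c x) = c * f x)"

definition weak_top :: "('a, 'b) ovs_scheme \<Rightarrow> 'a topology \<Rightarrow> 'a topology" where
  "weak_top V T =
     topology_generated_by
       {{x \<in> carr V. f x \<in> U} | f U.
          linear_functional V f \<and> continuous_map T euclideanreal f \<and> open U}"

definition schur_property ::
  "('a, 'b) ovs_scheme \<Rightarrow> 'a topology \<Rightarrow> 'a topology \<Rightarrow> bool" where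
  "schur_property V T1 T2 \<longleftrightarrow>
     (\<forall>x::nat \<Rightarrow> 'a. (\<forall>n. x n \<in> carr V) \<and> limitin T1 x (zer V) sequentially \<longrightarrow>
        limitin T2 x (zer V) sequentially)"

definition positive_schur_property ::
  "('a, 'b) ovs_scheme \<Rightarrow> 'a topology \<Rightarrow> 'a topology \<Rightarrow> bool" where
  "positive_schur_property V T1 T2 \<longleftrightarrow>
     (\<forall>x::nat \<Rightarrow> 'a. (\<forall>n. x n \<in> carr V \<and> leq V (zer V) (x n)) \<and>
        limitin T1 x (zer V) sequentially \<longrightarrow> limitin T2 x (zer V) sequentially)"

end

theory Submission
  imports Defs
begin

text \<open>The positive Schur property makes order bounded increasing sequences Cauchy: for a
  continuous functional \<open>f\<close>, which is bounded on order intervals, the values of \<open>f\<close> on the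
  successive differences are absolutely summable, so the differences are weakly null and hence
  \<open>\<tau>\<close>-null. By completeness, \<open>[0, x] \<inter> I\<close> then converges along its own order to an element
  \<open>u\<close> of the closed ideal \<open>I\<close>, and \<open>x - u\<close> is disjoint from \<open>I\<close>. So \<open>E\<close> is the direct sum
  of \<open>I\<close> and its disjoint complement, and \<open>E/I\<close> embeds into \<open>E\<close> as that complement by a
  positive continuous linear map, through which both Schur properties are inherited.\<close>

section \<open>Convergence in generated topologies and in topologies of Riesz seminorms\<close>

text \<open>The sets that \<open>f\<close> eventually enters as soon as they contain
  \<open>l\<close> are stable under finite intersections and arbitrary unions, so a subbase suffices
  as a test. The condition \<open>l \<in> \<Union>S\<close> says that \<open>l\<close> is a point of
  the space.\<close>

lemma limitin_topology_generated_by: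
  "limitin (topology_generated_by S) f l F \<longleftrightarrow>
     l \<in> \<Union>S \<and> (\<forall>U\<in>S. l \<in> U \<longrightarrow> eventually (\<lambda>x. f x \<in> U) F)"
proof
  assume "limitin (topology_generated_by S) f l F"
  then show "l \<in> \<Union>S \<and> (\<forall>U\<in>S. l \<in> U \<longrightarrow> eventually (\<lambda>x. f x \<in> U) F)"
    by (auto simp: limitin_def topology_generated_by_topspace topology_generated_by_Basis)
next
  assume R: "l \<in> \<Union>S \<and> (\<forall>U\<in>S. l \<in> U \<longrightarrow> eventually (\<lambda>x. f x \<in> U) F)"
  have "eventually (\<lambda>x. f x \<in> U) F" if "generate_topology_on S U" "l \<in> U" for U
    using that
  proof (induction rule: generate_topology_on.induct)
    case (Int a b)
    then show ?case by (auto intro: eventually_conj)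
  next
    case (UN K)
    then obtain k where "k \<in> K" "l \<in> k" by blast
    with UN have "eventually (\<lambda>x. f x \<in> k) F" by blast
    then show ?case by eventually_elim (use \<open>k \<in> K\<close> in blast)
  qed (use R in auto)
  with R show "limitin (topology_generated_by S) f l F"
    by (auto simp: limitin_def topology_generated_by_topspace openin_topology_generated_by_iff)
qed

lemma riesz_seminorm_mono: "riesz_seminorm p \<Longrightarrow> \<bar>x\<bar> \<le> \<bar>y\<bar> \<Longrightarrow> p x \<le> p y"
  and riesz_seminorm_triangle: "riesz_seminorm p \<Longrightarrow> p (x + y) \<le> p x + p y"
  and riesz_seminorm_scale: "riesz_seminorm p \<Longrightarrow> p (c *\<^sub>R x) = \<bar>c\<bar> * p x"
  by (auto simp: riesz_seminorm_def)

lemma riesz_seminorm_zero: "riesz_seminorm p \<Longrightarrow> p 0 = 0"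
  using riesz_seminorm_scale[of p 0 0] by simp

text \<open>Positivity follows from monotonicity in the modulus, applied to
  \<open>\<bar>0\<bar> \<le> \<bar>x\<bar>\<close>.\<close>

lemma riesz_seminorm_nonneg: "riesz_seminorm p \<Longrightarrow> 0 \<le> p x"
  using riesz_seminorm_mono[of p 0 x] by (simp add: riesz_seminorm_zero)

lemma riesz_seminorm_minus_commute: "riesz_seminorm p \<Longrightarrow> p (x - y) = p (y - x)"
  by (intro antisym riesz_seminorm_mono) (simp_all add: abs_minus_commute)

lemma topspace_seminorm_topology [simp]: "topspace (seminorm_topology P) = UNIV"
  by (auto simp: seminorm_topology_def topology_generated_by_topspace)

lemma limitin_seminorm_topology:
  assumes P: "\<forall>p\<in>P. riesz_seminorm p"
  shows "limitin (seminorm_topology P) f l F \<longleftrightarrow>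
           (\<forall>p\<in>P. \<forall>e>0. eventually (\<lambda>x. p (f x - l) < e) F)" (is "_ \<longleftrightarrow> ?R")
proof
  assume L: "limitin (seminorm_topology P) f l F"
  show ?R
  proof (intro ballI allI impI)
    fix p and e :: real assume "p \<in> P" "0 < e"
    then have "{y. p (y - l) < e} \<in> insert UNIV {{y. p (y - x) < e} | p x e. p \<in> P \<and> 0 < e}"
      by blast
    moreover have "l \<in> {y. p (y - l) < e}"
      using \<open>0 < e\<close> bspec[OF P \<open>p \<in> P\<close>] by (simp add: riesz_seminorm_zero)
    ultimately have "eventually (\<lambda>x. f x \<in> {y. p (y - l) < e}) F"
      using L unfolding seminorm_topology_def limitin_topology_generated_by by blast
    then show "eventually (\<lambda>x. p (f x - l) < e) F" by simp
  qed
next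
  assume R: ?R
  \<comment> \<open>A subbasic ball may be centred at any \<open>z\<close>. If it contains
    \<open>l\<close>, it contains the ball around \<open>l\<close> of radius
    \<open>e - p (l - z)\<close>.\<close>
  have "eventually (\<lambda>x. p (f x - z) < e) F" if "p \<in> P" "p (l - z) < e" for p z e
  proof -
    from R that have "eventually (\<lambda>x. p (f x - l) < e - p (l - z)) F" by simp
    then show ?thesis
    proof eventually_elim
      case (elim x)
      with riesz_seminorm_triangle[OF bspec[OF P \<open>p \<in> P\<close>], of "f x - l" "l - z"]
      show ?case by simp
    qed
  qed
  then show "limitin (seminorm_topology P) f l F"
    unfolding seminorm_topology_def limitin_topology_generated_by by auto
qed

text \<open>Being Cauchy means that the difference map tends to 0 along the product filter, so the
  criterion for limits applies.\<close>

lemma cauchy_filter_on_seminorm_topology: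
  assumes "\<forall>p\<in>P. riesz_seminorm p"
  shows "cauchy_filter_on (seminorm_topology P) F \<longleftrightarrow>
           (\<forall>p\<in>P. \<forall>e>0. eventually (\<lambda>(x, y). p (x - y) < e) (F \<times>\<^sub>F F))"
proof -
  have "cauchy_filter_on (seminorm_topology P) F \<longleftrightarrow>
          limitin (seminorm_topology P) (\<lambda>(x, y). x - y) 0 (F \<times>\<^sub>F F)"
    by (simp add: cauchy_filter_on_def limitin_def case_prod_unfold)
  then show ?thesis
    by (simp add: limitin_seminorm_topology[OF assms] case_prod_unfold)
qed

text \<open>The constant sequence \<open>z\<close> converges both to \<open>z\<close> and to
  0.\<close>

lemma Hausdorff_seminorm_topology_zero:
  assumes P: "\<forall>p\<in>P. riesz_seminorm p"
    and H: "Hausdorff_space (seminorm_topology P)"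
    and z: "\<And>p. p \<in> P \<Longrightarrow> p z = 0"
  shows "z = 0"
proof -
  have "limitin (seminorm_topology P) (\<lambda>_::nat. z) z sequentially"
    by (simp add: limitin_const)
  moreover have "limitin (seminorm_topology P) (\<lambda>_::nat. z) 0 sequentially"
    by (simp add: limitin_seminorm_topology[OF P] z)
  ultimately show ?thesis
    using limitin_Hausdorff_unique[OF _ _ trivial_limit_sequentially H] by blast
qed

text \<open>By linearity and monotonicity, no seminorm in \<open>P\<close> is increased by
  \<open>f\<close> on differences. This will give the continuity of the projection onto the
  complement of an ideal.\<close>

lemma continuous_map_seminorm_topology_contraction:
  assumes P: "\<forall>p\<in>P. riesz_seminorm p"
    and f: "linear f" and c: "\<And>x. \<bar>f x\<bar> \<le> \<bar>x\<bar>"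
  shows "continuous_map (seminorm_topology P) (seminorm_topology P) f"
  unfolding continuous_map_atin
proof
  fix x
  have "limitin (seminorm_topology P) (\<lambda>y. y) x (atin (seminorm_topology P) x)"
    by (auto simp: limitin_def eventually_atin)
  then have L: "\<forall>p\<in>P. \<forall>e>0.
      eventually (\<lambda>y. p (y - x) < e) (atin (seminorm_topology P) x)"
    by (simp add: limitin_seminorm_topology[OF P])
  have "p (f y - f x) \<le> p (y - x)" if "p \<in> P" for p y
    using riesz_seminorm_mono[OF bspec[OF P that] c[of "y - x"]] by (simp add: linear_diff[OF f])
  with L show "limitin (seminorm_topology P) f (f x) (atin (seminorm_topology P) x)"
    unfolding limitin_seminorm_topology[OF P] by (blast intro: eventually_mono le_less_trans)
qed

section \<open>Weak topologies and the two Schur properties\<close>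

lemma limitin_weak_top:
  assumes l: "l \<in> carr V" and x: "\<And>n. x n \<in> carr V"
  shows "limitin (weak_top V T) x l F \<longleftrightarrow>
           (\<forall>f. linear_functional V f \<and> continuous_map T euclideanreal f \<longrightarrow>
                ((\<lambda>n. f (x n)) \<longlongrightarrow> f l) F)"
proof -
  define S where "S = {{x \<in> carr V. f x \<in> U} | f U.
              linear_functional V f \<and> continuous_map T euclideanreal f \<and> open U}"
  have S: "{x \<in> carr V. f x \<in> U} \<in> S"
    if "linear_functional V f" "continuous_map T euclideanreal f" "open U" for f U
    unfolding S_def using that by blast
  \<comment> \<open>The zero functional with \<open>U = UNIV\<close> makes the carrier itself a
    subbasic set, so \<open>l\<close> is a point of the space.\<close>
  have "linear_functional V (\<lambda>_. 0)" by (simp add: linear_functional_def)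
  from S[OF this continuous_map_canonical_const open_UNIV] l have "l \<in> \<Union>S" by auto
  then have "limitin (weak_top V T) x l F \<longleftrightarrow>
      (\<forall>U\<in>S. l \<in> U \<longrightarrow> eventually (\<lambda>n. x n \<in> U) F)"
    unfolding weak_top_def limitin_topology_generated_by S_def[symmetric] by (iprover intro: iffI conjI elim: conjE)
  also have "\<dots> \<longleftrightarrow> (\<forall>f. linear_functional V f \<and> continuous_map T euclideanreal f \<longrightarrow>
                ((\<lambda>n. f (x n)) \<longlongrightarrow> f l) F)" (is "?L \<longleftrightarrow> ?R")
  proof
    assume L: ?L
    show ?R
    proof (intro allI impI topological_tendstoI; elim conjE)
      fix f and U :: "real set"
      assume f: "linear_functional V f" "continuous_map T euclideanreal f"
        and U: "open U" "f l \<in> U"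
      have "eventually (\<lambda>n. x n \<in> {x \<in> carr V. f x \<in> U}) F"
        using bspec[OF L S[OF f U(1)]] l U(2) by simp
      then show "eventually (\<lambda>n. f (x n) \<in> U) F" by (rule eventually_mono) simp
    qed
  next
    assume R: ?R
    show ?L
    proof (intro ballI impI)
      fix U assume "U \<in> S" "l \<in> U"
      then obtain f W where f: "linear_functional V f" "continuous_map T euclideanreal f"
        and W: "open W" "f l \<in> W" "U = {x \<in> carr V. f x \<in> W}"
        unfolding S_def by blast
      have "((\<lambda>n. f (x n)) \<longlongrightarrow> f l) F" using R f by blast
      then have "eventually (\<lambda>n. f (x n) \<in> W) F" using W(1,2) by (rule topological_tendstoD)
      then show "eventually (\<lambda>n. x n \<in> U) F" using W(3) x by simp
    qed
  qed
  finally show ?thesis .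
qed

lemma linear_functional_whole_space: "linear_functional whole_space f \<longleftrightarrow> linear f"
  by (auto simp: linear_functional_def whole_space_def linear_iff)

lemma whole_space_sel [simp]:
  "carr whole_space = UNIV" "zer whole_space = 0" "leq whole_space = (\<le>)"
  by (simp_all add: whole_space_def)

lemma limitin_weak_top_whole_space:
  "limitin (weak_top whole_space T) x l F \<longleftrightarrow>
     (\<forall>f. linear f \<and> continuous_map T euclideanreal f \<longrightarrow> ((\<lambda>n. f (x n)) \<longlongrightarrow> f l) F)"
  by (simp add: limitin_weak_top linear_functional_whole_space)

text \<open>Makes the projection, which is built from the positive property, available for the full
  Schur property as well.\<close>

lemma schur_imp_positive_schur: "schur_property V T1 T2 \<Longrightarrow> positive_schur_property V T1 T2"
  by (auto simp: schur_property_def positive_schur_property_def)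

section \<open>Order bounded increasing sequences and directed sets\<close>

text \<open>Unboundedness would give \<open>y n\<close> in the order interval with
  \<open>\<bar>f (y n)\<bar>\<close> above \<open>n + 1\<close>. Divided by \<open>n + 1\<close>
  these elements tend to 0, as \<open>p (y n) \<le> p u\<close> for each seminorm, yet
  \<open>f\<close> keeps modulus above 1 on them.\<close>

lemma continuous_functional_order_bounded:
  fixes f :: "'a::riesz_space \<Rightarrow> real"
  assumes P: "\<forall>p\<in>P. riesz_seminorm p"
    and f: "linear f" "continuous_map (seminorm_topology P) euclideanreal f"
  obtains C where "\<And>y. \<bar>y\<bar> \<le> u \<Longrightarrow> \<bar>f y\<bar> \<le> C"
proof -
  have "\<exists>C. \<forall>y. \<bar>y\<bar> \<le> u \<longrightarrow> \<bar>f y\<bar> \<le> C"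
  proof (rule ccontr)
    assume "\<not> ?thesis"
    then have "\<forall>n::nat. \<exists>y. \<bar>y\<bar> \<le> u \<and> real (Suc n) < \<bar>f y\<bar>"
      by (simp add: not_le)
    from choice[OF this] obtain y
      where y: "\<And>n. \<bar>y n\<bar> \<le> u" "\<And>n. real (Suc n) < \<bar>f (y n)\<bar>" by blast
    define z where "z n = inverse (real (Suc n)) *\<^sub>R y n" for n
    have "limitin (seminorm_topology P) z 0 sequentially"
      unfolding limitin_seminorm_topology[OF P]
    proof (intro ballI allI impI)
      fix p and e :: real assume p: "p \<in> P" and "0 < e"
      have "(\<lambda>n. p u * inverse (real (Suc n))) \<longlonglongrightarrow> p u * 0"
        by (rule tendsto_mult_left[OF LIMSEQ_inverse_real_of_nat])
      then have "eventually (\<lambda>n. p u * inverse (real (Suc n)) < e) sequentially"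
        by (rule order_tendstoD(2)) (use \<open>0 < e\<close> in simp)
      then show "eventually (\<lambda>n. p (z n - 0) < e) sequentially"
      proof eventually_elim
        case (elim n)
        have "p (y n) \<le> p u"
          by (rule riesz_seminorm_mono[OF bspec[OF P p] order_trans[OF y(1) abs_ge_self]])
        then have "p (z n) \<le> p u * inverse (real (Suc n))"
          by (simp add: z_def riesz_seminorm_scale[OF bspec[OF P p]] mult.commute mult_left_mono)
        with elim show ?case by simp
      qed
    qed
    then have "limitin euclideanreal (f \<circ> z) (f 0) sequentially"
      by (rule continuous_map_limit[OF f(2)])
    then have "(\<lambda>n. f (z n)) \<longlonglongrightarrow> 0"
      by (simp add: o_def linear_0[OF f(1)])
    from order_tendstoD(2)[OF tendsto_rabs_zero[OF this] zero_less_one]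
    obtain n where "\<bar>f (z n)\<bar> < 1" by (auto simp: eventually_sequentially)
    moreover have "\<bar>f (z n)\<bar> = \<bar>f (y n)\<bar> / real (Suc n)"
      by (simp add: z_def linear_cmul[OF f(1)] abs_mult divide_inverse)
    ultimately show False using y(2)[of n] by (simp add: divide_less_eq)
  qed
  with that show ?thesis by blast
qed

lemma monotone_differences_weakly_null:
  fixes s :: "nat \<Rightarrow> 'a::riesz_space"
  assumes P: "\<forall>p\<in>P. riesz_seminorm p"
    and s: "\<And>n. s n \<le> s (Suc n)" "\<And>n. s n \<le> b"
  shows "limitin (weak_top whole_space (seminorm_topology P)) (\<lambda>n. s (Suc n) - s n) 0 sequentially"
  unfolding limitin_weak_top_whole_space
proof (intro allI impI; elim conjE)
  fix f :: "'a \<Rightarrow> real"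
  assume f: "linear f" "continuous_map (seminorm_topology P) euclideanreal f"
  define d where "d n = s (Suc n) - s n" for n
  have d: "0 \<le> d n" for n using s by (simp add: d_def)
  obtain C where C: "\<And>y. \<bar>y\<bar> \<le> b - s 0 \<Longrightarrow> \<bar>f y\<bar> \<le> C"
    using continuous_functional_order_bounded[OF P f] by blast
  have "(\<Sum>n<N. \<bar>f (d n)\<bar>) \<le> C" for N
  proof -
    \<comment> \<open>The signs turn the sum of the \<open>\<bar>f (d n)\<bar>\<close> into a single
      value of \<open>f\<close>, taken at an element of modulus at most
      \<open>s N - s 0 \<le> b - s 0\<close>. Hence the bound \<open>C\<close> does not depend on
      \<open>N\<close>.\<close>
    have "\<bar>\<Sum>n<N. sgn (f (d n)) *\<^sub>R d n\<bar> \<le> (\<Sum>n<N. \<bar>sgn (f (d n)) *\<^sub>R d n\<bar>)"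
      by (rule sum_abs)
    also have "\<dots> \<le> (\<Sum>n<N. d n)"
      by (rule sum_mono) (use d in \<open>auto simp: sgn_real_def\<close>)
    also have "\<dots> = s N - s 0" by (simp add: d_def sum_lessThan_telescope)
    also have "\<dots> \<le> b - s 0" using s(2)[of N] by simp
    finally have "\<bar>f (\<Sum>n<N. sgn (f (d n)) *\<^sub>R d n)\<bar> \<le> C" by (rule C)
    moreover have "f (\<Sum>n<N. sgn (f (d n)) *\<^sub>R d n) = (\<Sum>n<N. \<bar>f (d n)\<bar>)"
      by (simp add: linear_sum[OF f(1)] linear_cmul[OF f(1)] abs_sgn mult.commute)
    ultimately show ?thesis by simp
  qed
  then have "summable (\<lambda>n. \<bar>f (d n)\<bar>)"
    by (intro bounded_imp_summable[where B = C]) (simp_all only: lessThan_Suc_atMost[symmetric] abs_ge_zero)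
  then have "(\<lambda>n. f (d n)) \<longlonglongrightarrow> 0"
    using summable_LIMSEQ_zero tendsto_rabs_zero_iff by blast
  then show "(\<lambda>n. f (s (Suc n) - s n)) \<longlonglongrightarrow> f 0"
    by (simp add: d_def linear_0[OF f(1)])
qed

text \<open>\<open>D\<close> is regarded as a net indexed by itself. The positive Schur property
  makes it Cauchy, completeness gives a limit \<open>u\<close>, and closedness puts \<open>u\<close>
  into \<open>I\<close>. Since the order passes to limits, \<open>u\<close> is the supremum of
  \<open>D\<close>.\<close>

lemma directed_set_convergent:
  fixes D :: "'a::riesz_space set"
  assumes P: "\<forall>p\<in>P. riesz_seminorm p"
    and H: "Hausdorff_space (seminorm_topology P)"
    and compl: "complete_topology (seminorm_topology P)"
    and psp: "positive_schur_property whole_space (weak_top whole_space (seminorm_topology P))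
                (seminorm_topology P)"
    and D: "D \<noteq> {}" "\<And>x y. x \<in> D \<Longrightarrow> y \<in> D \<Longrightarrow> sup x y \<in> D" "\<And>x. x \<in> D \<Longrightarrow> x \<le> b"
    and closed: "closedin (seminorm_topology P) I" "D \<subseteq> I"
  obtains u where "u \<in> I" "\<And>x. x \<in> D \<Longrightarrow> x \<le> u"
    "\<And>c. (\<And>x. x \<in> D \<Longrightarrow> x \<le> c) \<Longrightarrow> u \<le> c"
proof -
  let ?T = "seminorm_topology P"
  \<comment> \<open>Otherwise every element of \<open>D\<close> lies below another one at
    \<open>p\<close>-distance at least \<open>e\<close>. Dependent choice then gives an increasing
    sequence bounded by \<open>b\<close> whose differences are weakly null and positive, but not
    null.\<close>
  have tail: "\<exists>d\<in>D. \<forall>y\<in>D. d \<le> y \<longrightarrow> p (y - d) < e" if p: "p \<in> P" and e: "0 < e" for p and e :: real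
  proof (rule ccontr)
    assume "\<not> ?thesis"
    then have step: "\<forall>d\<in>D. \<exists>y\<in>D. d \<le> y \<and> e \<le> p (y - d)"
      by (simp add: not_less)
    have "\<exists>s. \<forall>n. s n \<in> D \<and> (s n \<le> s (Suc n) \<and> e \<le> p (s (Suc n) - s n))"
    proof (rule dependent_nat_choice)
      show "\<exists>x. x \<in> D" using D(1) by blast
      show "\<exists>y. y \<in> D \<and> x \<le> y \<and> e \<le> p (y - x)" if "x \<in> D" for x
        using bspec[OF step that] by blast
    qed
    then obtain s where s: "\<And>n. s n \<in> D" "\<And>n. s n \<le> s (Suc n)"
      "\<And>n. e \<le> p (s (Suc n) - s n)" by blast
    have "limitin (weak_top whole_space ?T) (\<lambda>n. s (Suc n) - s n) 0 sequentially"
      by (rule monotone_differences_weakly_null[where b = b]) (use P s(1,2) D(3) in blast)+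
    then have "limitin ?T (\<lambda>n. s (Suc n) - s n) 0 sequentially"
      using psp s(2) by (simp add: positive_schur_property_def)
    then have "eventually (\<lambda>n. p (s (Suc n) - s n) < e) sequentially"
      using p e by (simp add: limitin_seminorm_topology[OF P])
    then obtain n where "p (s (Suc n) - s n) < e" by (auto simp: eventually_sequentially)
    with s(3)[of n] show False by simp
  qed
  \<comment> \<open>The filter of tails of the net \<open>D\<close>. Closure under
    \<open>sup\<close> makes the tails a filter base.\<close>
  define F where "F = (INF d\<in>D. principal {y \<in> D. d \<le> y})"
  have F: "eventually Q F \<longleftrightarrow> (\<exists>d\<in>D. \<forall>y\<in>D. d \<le> y \<longrightarrow> Q y)" for Q
    unfolding F_def
  proof (subst eventually_INF_base)
    fix x y assume "x \<in> D" "y \<in> D"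
    then show "\<exists>z\<in>D. principal {w \<in> D. z \<le> w} \<le>
        inf (principal {w \<in> D. x \<le> w}) (principal {w \<in> D. y \<le> w})"
      by (intro bexI[of _ "sup x y"]) (auto simp: D)
  qed (use D(1) in \<open>auto simp: eventually_principal\<close>)
  have "F \<noteq> bot"
    using F[of "\<lambda>_. False"] by (auto simp: trivial_limit_def)
  moreover have "cauchy_filter_on ?T F"
    unfolding cauchy_filter_on_seminorm_topology[OF P]
  proof (intro ballI allI impI)
    fix p and e :: real assume p: "p \<in> P" and "0 < e"
    then obtain d where d: "d \<in> D" "\<And>y. y \<in> D \<Longrightarrow> d \<le> y \<Longrightarrow> p (y - d) < e / 2"
      using tail[of p "e / 2"] by auto
    have "eventually (\<lambda>y. p (y - d) < e / 2) F" using d by (auto simp: F)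
    moreover have "p (x - y) < e" if "p (x - d) < e / 2" "p (y - d) < e / 2" for x y
      using that riesz_seminorm_triangle[OF bspec[OF P p], of "x - d" "d - y"]
        riesz_seminorm_minus_commute[OF bspec[OF P p], of d y] by simp
    ultimately show "eventually (\<lambda>(x, y). p (x - y) < e) (F \<times>\<^sub>F F)"
      unfolding eventually_prod_filter by (auto intro!: exI[of _ "\<lambda>y. p (y - d) < e / 2"])
  qed
  ultimately obtain u where u: "limitin ?T (\<lambda>x. x) u F"
    using compl by (auto simp: complete_topology_def)
  \<comment> \<open>Points of \<open>D\<close> near the limit can be found above any prescribed
    \<open>d\<close>: a tail that is near \<open>u\<close> starts at some \<open>d'\<close>, and
    \<open>sup d d'\<close> belongs to it.\<close>
  have close: "\<exists>y\<in>D. d \<le> y \<and> p (y - u) < e" if "d \<in> D" "p \<in> P" "0 < e" for d p and e :: real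
  proof -
    have "eventually (\<lambda>y. p (y - u) < e) F"
      using u that by (simp add: limitin_seminorm_topology[OF P])
    then obtain d' where "d' \<in> D" "\<And>y. y \<in> D \<Longrightarrow> d' \<le> y \<Longrightarrow> p (y - u) < e" by (auto simp: F)
    then show ?thesis using D(2)[OF \<open>d \<in> D\<close> \<open>d' \<in> D\<close>] by (intro bexI[of _ "sup d d'"]) auto
  qed
  \<comment> \<open>The order is compared with the topology through the positive part
    \<open>sup a 0\<close>. It is dominated by elements of arbitrarily small seminorm, so every
    seminorm vanishes on it, and the Hausdorff property makes it 0.\<close>
  have zero: "a \<le> 0"
    if a: "\<And>p e. p \<in> P \<Longrightarrow> 0 < e \<Longrightarrow> \<exists>y. a \<le> \<bar>y\<bar> \<and> p y < e" for a
  proof -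
    have "p (sup a 0) = 0" if p: "p \<in> P" for p
    proof (rule ccontr)
      assume "p (sup a 0) \<noteq> 0"
      then have "0 < p (sup a 0)" using riesz_seminorm_nonneg[OF bspec[OF P p], of "sup a 0"] by simp
      then obtain y where y: "a \<le> \<bar>y\<bar>" "p y < p (sup a 0)" using a[OF p] by blast
      have "p (sup a 0) \<le> p y"
        by (rule riesz_seminorm_mono[OF bspec[OF P p]]) (use y(1) in \<open>simp\<close>)
      with y show False by simp
    qed
    then have "sup a 0 = 0" by (rule Hausdorff_seminorm_topology_zero[OF P H])
    then show ?thesis by (simp add: le_iff_sup)
  qed
  show ?thesis
  proof
    have "eventually (\<lambda>x. x \<in> I) F" using D(1) closed(2) by (auto simp: F)
    then show "u \<in> I" using limitin_closedin[OF u closed(1)] \<open>F \<noteq> bot\<close> by simp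
  next
    fix x assume "x \<in> D"
    have "x - u \<le> 0"
    proof (rule zero)
      fix p and e :: real assume "p \<in> P" "0 < e"
      then obtain y where "x \<le> y" "p (y - u) < e" using close \<open>x \<in> D\<close> by blast
      moreover from \<open>x \<le> y\<close> have "x - u \<le> \<bar>y - u\<bar>"
        by (meson abs_ge_self diff_right_mono order_trans)
      ultimately show "\<exists>y. x - u \<le> \<bar>y\<bar> \<and> p y < e" by blast
    qed
    then show "x \<le> u" by simp
  next
    fix c assume c: "\<And>x. x \<in> D \<Longrightarrow> x \<le> c"
    have "u - c \<le> 0"
    proof (rule zero)
      fix p and e :: real assume "p \<in> P" "0 < e"
      then obtain y where "y \<in> D" "p (y - u) < e" using close D(1) by blast
      moreover from c[OF \<open>y \<in> D\<close>] have "u - c \<le> \<bar>y - u\<bar>"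
        by (metis abs_ge_self abs_minus_commute diff_left_mono order_trans)
      ultimately show "\<exists>y. u - c \<le> \<bar>y\<bar> \<and> p y < e" by blast
    qed
    then show "u \<le> c" by simp
  qed
qed

section \<open>The disjoint complement and the projection along a closed ideal\<close>

text \<open>For an ideal \<open>I\<close> this is the usual disjoint complement:
  \<open>inf \<bar>v\<bar> \<bar>y\<bar>\<close> lies in \<open>I\<close> for each \<open>y\<close>
  in \<open>I\<close> and is dominated by \<open>\<bar>v\<bar>\<close>.\<close>

definition ideal_complement :: "'a::riesz_space set \<Rightarrow> 'a set" where
  "ideal_complement I = {v. \<forall>y\<in>I. \<bar>y\<bar> \<le> \<bar>v\<bar> \<longrightarrow> y = 0}"

lemma riesz_idealD:
  assumes "riesz_ideal I"
  shows "subspace I" and "y \<in> I \<Longrightarrow> \<bar>x\<bar> \<le> \<bar>y\<bar> \<Longrightarrow> x \<in> I"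
  using assms unfolding riesz_ideal_def by blast+

lemma ideal_complement_Int:
  "v \<in> I \<Longrightarrow> v \<in> ideal_complement I \<Longrightarrow> v = 0"
  by (auto simp: ideal_complement_def)

lemma abs_scaleR_le:
  fixes x :: "'a::riesz_space"
  shows "\<bar>c *\<^sub>R x\<bar> \<le> \<bar>c\<bar> *\<^sub>R \<bar>x\<bar>"
proof (rule abs_leI)
  have *: "d *\<^sub>R y \<le> \<bar>d\<bar> *\<^sub>R \<bar>y\<bar>" for d :: real and y :: 'a
  proof (cases "0 \<le> d")
    case True
    then show ?thesis by (simp add: scaleR_left_mono[OF abs_ge_self])
  next
    case False
    then have "(- d) *\<^sub>R (- y) \<le> (- d) *\<^sub>R \<bar>y\<bar>" by (intro scaleR_left_mono abs_ge_minus_self) simp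
    with False show ?thesis by simp
  qed
  show "c *\<^sub>R x \<le> \<bar>c\<bar> *\<^sub>R \<bar>x\<bar>" by (rule *)
  show "- (c *\<^sub>R x) \<le> \<bar>c\<bar> *\<^sub>R \<bar>x\<bar>" using *[of c "- x"] by simp
qed

lemma subspace_ideal_complement:
  assumes I: "riesz_ideal I"
  shows "subspace (ideal_complement I)"
proof (rule subspaceI)
  show "0 \<in> ideal_complement I" by (simp add: ideal_complement_def)
next
  fix v w assume v: "v \<in> ideal_complement I" and w: "w \<in> ideal_complement I"
  show "v + w \<in> ideal_complement I"
    unfolding ideal_complement_def
  proof (safe)
    fix y assume y: "y \<in> I" "\<bar>y\<bar> \<le> \<bar>v + w\<bar>"
    \<comment> \<open>The piece of \<open>\<bar>y\<bar>\<close> below \<open>\<bar>v\<bar>\<close>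
      stays in \<open>I\<close> by solidity, so it vanishes, and \<open>\<bar>w\<bar>\<close> alone
      must dominate \<open>\<bar>y\<bar>\<close>.\<close>
    define a where "a = inf \<bar>y\<bar> \<bar>v\<bar>"
    have a: "0 \<le> a" "a \<le> \<bar>y\<bar>" "a \<le> \<bar>v\<bar>" by (simp_all add: a_def)
    have "a \<in> I" by (rule riesz_idealD(2)[OF I y(1)]) (use a in simp)
    then have "a = 0" using v a by (auto simp: ideal_complement_def)
    have "\<bar>y\<bar> \<le> \<bar>v\<bar> + \<bar>w\<bar>" using y(2) abs_triangle_ineq order_trans by blast
    then have "\<bar>y\<bar> - \<bar>w\<bar> \<le> a" unfolding a_def by (simp add: algebra_simps)
    then have "\<bar>y\<bar> \<le> \<bar>w\<bar>" using \<open>a = 0\<close> by simp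
    then show "y = 0" using w y(1) by (auto simp: ideal_complement_def)
  qed
next
  fix c v assume v: "v \<in> ideal_complement I"
  show "c *\<^sub>R v \<in> ideal_complement I"
    unfolding ideal_complement_def
  proof (safe)
    fix y assume y: "y \<in> I" "\<bar>y\<bar> \<le> \<bar>c *\<^sub>R v\<bar>"
    show "y = 0"
    proof (cases "c = 0")
      case False
      \<comment> \<open>Multiplication by \<open>inverse c\<close> will bring \<open>y\<close> below
        \<open>\<bar>v\<bar>\<close> without leaving \<open>I\<close>.\<close>
      have "\<bar>y\<bar> \<le> \<bar>c\<bar> *\<^sub>R \<bar>v\<bar>" using y(2) abs_scaleR_le order_trans by blast
      then have "\<bar>inverse c\<bar> *\<^sub>R \<bar>y\<bar> \<le> \<bar>inverse c\<bar> *\<^sub>R \<bar>c\<bar> *\<^sub>R \<bar>v\<bar>"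
        by (rule scaleR_left_mono) simp
      also have "\<dots> = \<bar>v\<bar>" using False by (simp add: abs_mult[symmetric])
      finally have "\<bar>inverse c *\<^sub>R y\<bar> \<le> \<bar>v\<bar>" using abs_scaleR_le order_trans by blast
      moreover have "inverse c *\<^sub>R y \<in> I"
        using riesz_idealD(1)[OF I] y(1) by (rule subspace_scale)
      ultimately have "inverse c *\<^sub>R y = 0" using v by (auto simp: ideal_complement_def)
      then show ?thesis using False by simp
    qed (use y in simp)
  qed
qed

text \<open>Splitting the positive and negative parts of \<open>x\<close> splits \<open>x\<close>
  itself into a member of \<open>I\<close> and a member of the complement. The two subspaces meet
  only in 0, so the splitting is unique and its complement component \<open>Q x\<close> is linear in
  \<open>x\<close>.\<close>

lemma ideal_projection_exists:
  fixes I :: "'a::riesz_space set"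
  assumes I: "riesz_ideal I"
    and pos: "\<And>x. 0 \<le> x \<Longrightarrow> \<exists>u\<in>I. 0 \<le> u \<and> u \<le> x \<and> x - u \<in> ideal_complement I"
  obtains Q where "linear Q" "\<And>x. x - Q x \<in> I" "\<And>x. x \<in> I \<Longrightarrow> Q x = 0"
    "\<And>x. \<bar>Q x\<bar> \<le> \<bar>x\<bar>" "\<And>x. 0 \<le> x \<Longrightarrow> 0 \<le> Q x"
proof -
  note sI = riesz_idealD(1)[OF I] and sC = subspace_ideal_complement[OF I]
  have "\<exists>v\<in>ideal_complement I. x - v \<in> I" for x
  proof -
    \<comment> \<open>\<open>nprt x\<close> is the nonpositive element \<open>inf x 0\<close>, so
      the hypothesis is applied to its negative.\<close>
    obtain u w where u: "u \<in> I" "pprt x - u \<in> ideal_complement I"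
      and w: "w \<in> I" "- nprt x - w \<in> ideal_complement I"
      using pos[of "pprt x"] pos[of "- nprt x"] by auto
    show ?thesis
    proof (rule bexI)
      show "(pprt x - u) - (- nprt x - w) \<in> ideal_complement I"
        by (intro subspace_diff[OF sC] u w)
      have eq: "x - ((pprt x - u) - (- nprt x - w)) = u - w"
        using prts[of x] by (simp add: algebra_simps)
      show "x - ((pprt x - u) - (- nprt x - w)) \<in> I"
        unfolding eq by (rule subspace_diff[OF sI u(1) w(1)])
    qed
  qed
  then obtain Q where Q: "\<And>x. Q x \<in> ideal_complement I" "\<And>x. x - Q x \<in> I" by metis
  \<comment> \<open>\<open>Q x - v\<close> lies in the complement, and also in \<open>I\<close>,
    being the difference of \<open>x - v\<close> and \<open>x - Q x\<close>.\<close>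
  have uniq: "Q x = v" if "v \<in> ideal_complement I" "x - v \<in> I" for x v
  proof -
    have "Q x - v \<in> ideal_complement I" by (intro subspace_diff[OF sC] Q that)
    moreover have "(x - v) - (x - Q x) \<in> I" by (intro subspace_diff[OF sI] Q that)
    ultimately show ?thesis using ideal_complement_Int[of "Q x - v" I] by simp
  qed
  have lin: "linear Q"
  proof (rule linearI)
    fix x y
    have "(x - Q x) + (y - Q y) \<in> I" by (intro subspace_add[OF sI] Q)
    then show "Q (x + y) = Q x + Q y"
      by (intro uniq subspace_add[OF sC] Q) (simp add: algebra_simps)
  next
    fix c x
    have "c *\<^sub>R (x - Q x) \<in> I" by (intro subspace_scale[OF sI] Q)
    then show "Q (c *\<^sub>R x) = c *\<^sub>R Q x"
      by (intro uniq subspace_scale[OF sC] Q) (simp add: algebra_simps)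
  qed
  have bnd: "0 \<le> Q x \<and> Q x \<le> x" if x: "0 \<le> x" for x
  proof -
    obtain u where u: "u \<in> I" "0 \<le> u" "u \<le> x" "x - u \<in> ideal_complement I"
      using pos[OF x] by blast
    then have "Q x = x - u" by (intro uniq) auto
    with u show ?thesis by simp
  qed
  have "\<bar>Q x\<bar> \<le> \<bar>x\<bar>" for x
  proof -
    have p: "0 \<le> Q (pprt x)" "Q (pprt x) \<le> pprt x" using bnd[of "pprt x"] by auto
    have n: "0 \<le> Q (- nprt x)" "Q (- nprt x) \<le> - nprt x" using bnd[of "- nprt x"] by auto
    \<comment> \<open>The bounds \<open>0 \<le> Q z \<le> z\<close> for the two positive pieces add
      up to \<open>\<bar>x\<bar> = pprt x - nprt x\<close>.\<close>
    have "Q x = Q (pprt x) - Q (- nprt x)"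
      using prts[of x] by (simp add: linear_diff[OF lin, symmetric])
    then have "\<bar>Q x\<bar> \<le> \<bar>Q (pprt x)\<bar> + \<bar>Q (- nprt x)\<bar>"
      using abs_triangle_ineq4 by simp
    also have "\<dots> = Q (pprt x) + Q (- nprt x)" using p n by simp
    also have "\<dots> \<le> pprt x + - nprt x" by (intro add_mono p n)
    also have "\<dots> = \<bar>x\<bar>" by (simp add: abs_prts)
    finally show ?thesis .
  qed
  moreover have "Q x = 0" if "x \<in> I" for x
    using that subspace_0[OF sC] by (intro uniq) auto
  ultimately show ?thesis using that lin Q(2) bnd by blast
qed

text \<open>The component of a positive \<open>x\<close> in \<open>I\<close> is the supremum
  \<open>u\<close> of \<open>I \<inter> [0, x]\<close>, which exists in \<open>I\<close> by the
  convergence of directed sets.\<close>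

lemma closed_ideal_projection:
  fixes I :: "'a::riesz_space set"
  assumes P: "\<forall>p\<in>P. riesz_seminorm p"
    and H: "Hausdorff_space (seminorm_topology P)"
    and compl: "complete_topology (seminorm_topology P)"
    and psp: "positive_schur_property whole_space (weak_top whole_space (seminorm_topology P))
                (seminorm_topology P)"
    and I: "riesz_ideal I" and closed: "closedin (seminorm_topology P) I"
  obtains Q where "linear Q" "\<And>x. x - Q x \<in> I" "\<And>x. x \<in> I \<Longrightarrow> Q x = 0"
    "\<And>x. \<bar>Q x\<bar> \<le> \<bar>x\<bar>" "\<And>x. 0 \<le> x \<Longrightarrow> 0 \<le> Q x"
proof (rule ideal_projection_exists[OF I])
  fix x :: 'a assume x: "0 \<le> x"
  let ?D = "{d \<in> I. 0 \<le> d \<and> d \<le> x}"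
  have sI: "subspace I" using I by (rule riesz_idealD)
  have 0: "0 \<in> ?D" using subspace_0[OF sI] x by simp
  have sup: "sup a b \<in> ?D" if "a \<in> ?D" "b \<in> ?D" for a b
  proof -
    have "a + b \<in> I" using subspace_add[OF sI] that by blast
    have "0 \<le> sup a b" using that by (auto intro: le_supI1)
    \<comment> \<open>For positive \<open>a\<close> and \<open>b\<close> the sum dominates the
      supremum, so solidity keeps \<open>sup a b\<close> in \<open>I\<close>.\<close>
    moreover have "sup a b \<le> a + b" using that by simp
    ultimately have "\<bar>sup a b\<bar> \<le> \<bar>a + b\<bar>" by (simp add: order_trans[OF _ abs_ge_self])
    then have "sup a b \<in> I" by (rule riesz_idealD(2)[OF I \<open>a + b \<in> I\<close>])
    with \<open>0 \<le> sup a b\<close> that show ?thesis by simp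
  qed
  obtain u where u: "u \<in> I" "\<And>d. d \<in> ?D \<Longrightarrow> d \<le> u"
    "\<And>c. (\<And>d. d \<in> ?D \<Longrightarrow> d \<le> c) \<Longrightarrow> u \<le> c"
  proof (rule directed_set_convergent[OF P H compl psp, of ?D x I])
    show "?D \<noteq> {}" using 0 by blast
  qed (use sup closed in auto)
  have "u \<le> x" by (rule u(3)) simp
  moreover have "0 \<le> u" by (rule u(2)[OF 0])
  moreover have "x - u \<in> ideal_complement I"
    unfolding ideal_complement_def
  proof safe
    fix y assume y: "y \<in> I" "\<bar>y\<bar> \<le> \<bar>x - u\<bar>"
    have "\<bar>y\<bar> \<in> I" by (rule riesz_idealD(2)[OF I y(1)]) simp
    then have "u + \<bar>y\<bar> \<in> I" by (rule subspace_add[OF sI u(1)])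
    \<comment> \<open>Thus \<open>u + \<bar>y\<bar>\<close> again belongs to
      \<open>I \<inter> [0, x]\<close>, so it cannot exceed the supremum \<open>u\<close>.\<close>
    moreover have "u + \<bar>y\<bar> \<le> x" using y(2) \<open>u \<le> x\<close> by (simp add: algebra_simps)
    ultimately have "u + \<bar>y\<bar> \<le> u" using \<open>0 \<le> u\<close> by (intro u(2)) auto
    then show "y = 0" by simp
  qed
  ultimately show "\<exists>u\<in>I. 0 \<le> u \<and> u \<le> x \<and> x - u \<in> ideal_complement I"
    using u(1) by blast
qed (rule that)

section \<open>Cosets, the quotient topology and functionals on the quotient\<close>

lemma coset_eq_imp_diff_in:
  assumes "subspace I" "x +o I = y +o I"
  shows "x - y \<in> I"
proof -
  have "x \<in> x +o I" using subspace_0[OF assms(1)] by (auto simp: elt_set_plus_def)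
  then have "x \<in> y +o I" using assms(2) by simp
  then show ?thesis by (auto simp: elt_set_plus_def)
qed

lemma coset_cong:
  fixes x y :: "'a::real_vector"
  assumes "subspace I" "x - y \<in> I"
  shows "x +o I = y +o I"
proof -
  have "x +o I \<subseteq> y +o I" if "x - y \<in> I" for x y
  proof
    fix z assume "z \<in> x +o I"
    then have "z - x \<in> I" by (auto simp: elt_set_plus_def)
    with that have "(z - x) + (x - y) \<in> I" by (rule subspace_add[OF assms(1), rotated])
    then show "z \<in> y +o I" by (auto simp: elt_set_plus_def intro!: bexI[of _ "z - y"])
  qed
  from this[OF assms(2)] this[of y x] subspace_neg[OF assms(1) assms(2)] show ?thesis by auto
qed

lemma quotient_space_sel:
  "carr (quotient_space I) = range (\<lambda>x. x +o I)" "zer (quotient_space I) = 0 +o I"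
  by (simp_all add: quotient_space_def)

lemma topspace_quotient_top:
  assumes "topspace T = UNIV"
  shows "topspace (quotient_top T I) = range (\<lambda>x. x +o I)"
proof
  show "topspace (quotient_top T I) \<subseteq> range (\<lambda>x. x +o I)"
    using openin_topspace[of "quotient_top T I"] unfolding openin_quotient_top by blast
  have "openin (quotient_top T I) (range (\<lambda>x. x +o I))"
    using openin_topspace[of T] by (simp add: openin_quotient_top assms)
  then show "range (\<lambda>x. x +o I) \<subseteq> topspace (quotient_top T I)" by (rule openin_subset)
qed

text \<open>This is the continuity of the quotient map. It carries null sequences of
  \<open>E\<close> down to the quotient.\<close>

lemma limitin_quotient_top:
  assumes T: "topspace T = UNIV" and x: "limitin T x l F"
  shows "limitin (quotient_top T I) (\<lambda>n. x n +o I) (l +o I) F"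
  using x by (auto simp: limitin_def topspace_quotient_top[OF T] openin_quotient_top T)

text \<open>As \<open>Q\<close> vanishes on \<open>I\<close>, each \<open>f \<circ> Q\<close> with
  \<open>f\<close> continuous and linear factors through the quotient as a continuous functional
  \<open>g\<close>. Testing the cosets against \<open>g\<close> amounts to testing
  \<open>Q (a n)\<close> against \<open>f\<close>.\<close>

lemma weakly_null_projection:
  fixes a :: "nat \<Rightarrow> 'a::riesz_space"
  assumes T: "topspace T = UNIV" and I: "riesz_ideal I"
    and Q: "linear Q" "\<And>x. x \<in> I \<Longrightarrow> Q x = 0" "continuous_map T T Q"
    and a: "limitin (weak_top (quotient_space I) (quotient_top T I)) (\<lambda>n. a n +o I) (0 +o I) F"
  shows "limitin (weak_top whole_space T) (\<lambda>n. Q (a n)) 0 F"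
  unfolding limitin_weak_top_whole_space
proof (intro allI impI; elim conjE)
  fix f :: "'a \<Rightarrow> real"
  assume f: "linear f" "continuous_map T euclideanreal f"
  \<comment> \<open>A representative of the coset is chosen. The next fact shows that the choice
    does not affect the value.\<close>
  define g where "g A = f (Q (SOME x. A = x +o I))" for A
  have g: "g (x +o I) = f (Q x)" for x
  proof -
    have "x +o I = (SOME y. x +o I = y +o I) +o I" by (rule someI_ex) blast
    then have "x - (SOME y. x +o I = y +o I) \<in> I"
      by (rule coset_eq_imp_diff_in[OF riesz_idealD(1)[OF I]])
    then have "Q x = Q (SOME y. x +o I = y +o I)"
      using Q(2) linear_diff[OF Q(1)] by fastforce
    then show ?thesis by (simp add: g_def)
  qed
  have "linear_functional (quotient_space I) g"
    by (auto simp: linear_functional_def quotient_space_sel quotient_space_coset_ops[OF I] g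
        linear_add[OF f(1)] linear_add[OF Q(1)] linear_cmul[OF f(1)] linear_cmul[OF Q(1)])
  moreover have "continuous_map (quotient_top T I) euclideanreal g"
    unfolding continuous_map_def
  proof (intro conjI allI impI)
    fix U assume U: "openin euclideanreal U"
    have "continuous_map T euclideanreal (f \<circ> Q)" using Q(3) f(2) by (rule continuous_map_compose)
    then have "openin T {x. f (Q x) \<in> U}" using U by (simp add: continuous_map_def T)
    \<comment> \<open>The preimage of this set under the quotient map is the open set
      \<open>{x. f (Q x) \<in> U}\<close>.\<close>
    then show "openin (quotient_top T I) {A \<in> topspace (quotient_top T I). g A \<in> U}"
      by (auto simp: openin_quotient_top topspace_quotient_top[OF T] T g)
  qed simp
  ultimately have "((\<lambda>n. g (a n +o I)) \<longlongrightarrow> g (0 +o I)) F"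
    using a by (simp add: limitin_weak_top quotient_space_sel del: set_zero_plus)
  then show "((\<lambda>n. f (Q (a n))) \<longlongrightarrow> f 0) F"
    by (simp add: g linear_0[OF Q(1)] del: set_zero_plus)
qed

section \<open>Transfer of both Schur properties to the quotient\<close>

theorem theorem2p3:
  fixes \<tau> :: "'a::riesz_space topology"
  assumes "dedekind_sigma_complete TYPE('a)"
    and "locally_convex_solid \<tau>"
    and "Hausdorff_space \<tau>"
    and "complete_topology \<tau>"
  shows "(positive_schur_property (whole_space :: 'a ovs) (weak_top whole_space \<tau>) \<tau> \<longrightarrow>
            (\<forall>I. riesz_ideal I \<and> closedin \<tau> I \<longrightarrow>
               positive_schur_property (quotient_space I)
                 (weak_top (quotient_space I) (quotient_top \<tau> I)) (quotient_top \<tau> I)))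
       \<and> (schur_property (whole_space :: 'a ovs) (weak_top whole_space \<tau>) \<tau> \<longrightarrow>
            (\<forall>I. riesz_ideal I \<and> closedin \<tau> I \<longrightarrow>
               schur_property (quotient_space I)
                 (weak_top (quotient_space I) (quotient_top \<tau> I)) (quotient_top \<tau> I)))"
proof -
  obtain P where P: "\<forall>p\<in>P. riesz_seminorm p" and \<tau>: "\<tau> = seminorm_topology P"
    using assms(2) by (auto simp: locally_convex_solid_def)
  have top: "topspace \<tau> = UNIV" by (simp add: \<tau>)
  \<comment> \<open>Common to both parts: a weakly null sequence of cosets has weakly null
    representatives, namely the values of \<open>Q\<close>, and they are positive when all the
    cosets are.\<close>
  have lift: "\<exists>y. (\<forall>n. A n = y n +o I) \<and> limitin (weak_top whole_space \<tau>) y 0 sequentially \<and>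
      ((\<forall>n. leq (quotient_space I) (zer (quotient_space I)) (A n)) \<longrightarrow> (\<forall>n. 0 \<le> y n))"
    if psp: "positive_schur_property (whole_space :: 'a ovs) (weak_top whole_space \<tau>) \<tau>"
      and I: "riesz_ideal I" "closedin \<tau> I"
      and carr: "\<forall>n. A n \<in> carr (quotient_space I)"
      and A: "limitin (weak_top (quotient_space I) (quotient_top \<tau> I)) A
                (zer (quotient_space I)) sequentially"
    for I and A :: "nat \<Rightarrow> 'a set"
  proof -
    have sI: "subspace I" using I(1) by (rule riesz_idealD)
    obtain Q where Q: "linear Q" "\<And>x. x - Q x \<in> I" "\<And>x. x \<in> I \<Longrightarrow> Q x = 0"
      "\<And>x. \<bar>Q x\<bar> \<le> \<bar>x\<bar>" "\<And>x. 0 \<le> x \<Longrightarrow> 0 \<le> Q x"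
      using closed_ideal_projection[OF P, of I] assms(3,4) psp I unfolding \<tau> by blast
    have "\<forall>n. \<exists>a. A n = a +o I" using carr by (auto simp: quotient_space_sel)
    then obtain a where a: "\<And>n. A n = a n +o I" by metis
    have "A n = Q (a n) +o I" for n
      unfolding a by (rule coset_cong[OF sI Q(2)])
    moreover have "limitin (weak_top whole_space \<tau>) (\<lambda>n. Q (a n)) 0 sequentially"
    proof (rule weakly_null_projection[OF top I(1) Q(1,3)])
      show "continuous_map \<tau> \<tau> Q"
        unfolding \<tau> by (rule continuous_map_seminorm_topology_contraction[OF P Q(1,4)])
      show "limitin (weak_top (quotient_space I) (quotient_top \<tau> I)) (\<lambda>n. a n +o I) (0 +o I)
              sequentially"
        using A unfolding ext[of A, OF a] quotient_space_sel(2) .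
    qed
    moreover have "0 \<le> Q (a n)"
      if le: "leq (quotient_space I) (zer (quotient_space I)) (A n)" for n
    proof -
      \<comment> \<open>Positivity of the coset only gives \<open>x \<le> y\<close> with
        \<open>x\<close> in \<open>I\<close> and \<open>y\<close> in the coset of
        \<open>a n\<close>. Applying \<open>Q\<close> to \<open>y - x\<close> removes
        \<open>x\<close> and the \<open>I\<close>-part of \<open>y\<close>, leaving
        \<open>Q (a n)\<close>.\<close>
      obtain x y where xy: "x \<in> I" "y \<in> a n +o I" "x \<le> y"
        using le by (auto simp: quotient_space_def a)
      then obtain i where i: "i \<in> I" "y = a n + i" by (auto simp: elt_set_plus_def)
      have "0 \<le> Q (y - x)" using xy(3) by (intro Q(5)) simp
      also have "\<dots> = Q (a n)"
        using Q(3) xy(1) i by (simp add: linear_diff[OF Q(1)] linear_add[OF Q(1)])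
      finally show ?thesis .
    qed
    ultimately show ?thesis by (intro exI[of _ "\<lambda>n. Q (a n)"]) blast
  qed
  have null: "limitin (quotient_top \<tau> I) A (zer (quotient_space I)) sequentially"
    if "\<And>n. A n = y n +o I" "limitin \<tau> y 0 sequentially" for I A and y :: "nat \<Rightarrow> 'a"
    using limitin_quotient_top[OF top that(2), of I]
    unfolding ext[of A, OF that(1)] quotient_space_sel(2) .
  show ?thesis
  proof (intro conjI impI allI; elim conjE)
    fix I assume psp: "positive_schur_property (whole_space :: 'a ovs) (weak_top whole_space \<tau>) \<tau>"
      and I: "riesz_ideal I" "closedin \<tau> I"
    show "positive_schur_property (quotient_space I)
            (weak_top (quotient_space I) (quotient_top \<tau> I)) (quotient_top \<tau> I)"
      unfolding positive_schur_property_def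
    proof (intro allI impI; elim conjE)
      fix A :: "nat \<Rightarrow> 'a set"
      assume A: "\<forall>n. A n \<in> carr (quotient_space I) \<and>
          leq (quotient_space I) (zer (quotient_space I)) (A n)"
        "limitin (weak_top (quotient_space I) (quotient_top \<tau> I)) A
          (zer (quotient_space I)) sequentially"
      obtain y where y: "\<And>n. A n = y n +o I"
        "limitin (weak_top whole_space \<tau>) y 0 sequentially" "\<And>n. 0 \<le> y n"
        using lift[OF psp I _ A(2)] A(1) by blast
      have "limitin \<tau> y 0 sequentially"
        using psp y by (simp add: positive_schur_property_def)
      with y(1) show "limitin (quotient_top \<tau> I) A (zer (quotient_space I)) sequentially"
        by (rule null)
    qed
  next
    fix I assume sp: "schur_property (whole_space :: 'a ovs) (weak_top whole_space \<tau>) \<tau>"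
      and I: "riesz_ideal I" "closedin \<tau> I"
    show "schur_property (quotient_space I)
            (weak_top (quotient_space I) (quotient_top \<tau> I)) (quotient_top \<tau> I)"
      unfolding schur_property_def
    proof (intro allI impI; elim conjE)
      fix A :: "nat \<Rightarrow> 'a set"
      assume A: "\<forall>n. A n \<in> carr (quotient_space I)"
        "limitin (weak_top (quotient_space I) (quotient_top \<tau> I)) A
          (zer (quotient_space I)) sequentially"
      obtain y where y: "\<And>n. A n = y n +o I"
        "limitin (weak_top whole_space \<tau>) y 0 sequentially"
        using lift[OF schur_imp_positive_schur[OF sp] I A] by blast
      have "limitin \<tau> y 0 sequentially"
        using sp y(2) by (simp add: schur_property_def)
      with y(1) show "limitin (quotient_top \<tau> I) A (zer (quotient_space I)) sequentially"
        by (rule null)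
    qed
  qed
qed

end
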